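(* Let $(X,\sigma)$ be a Deaconu-Renault system with $X$ a metric space, and let $D$ be a dense subset of $\mathrm{Dom}(\sigma)$. If $(D,\sigma)$ has the shadowing property, then $(X,\sigma)$ has the shadowing property. If, moreover, $\mathrm{Dom}(\sigma)$ is dense in $X$ and $(D,\sigma)$ has the finite shadowing property, then $(X,\sigma)$ has the finite shadowing property.
   Context: A Deaconu-Renault system is a pair $(X,\sigma)$ consisting of a locally compact Hausdorff space $X$ and a local homeomorphism $\sigma:\mathrm{Dom}(\sigma)\to\mathrm{Im}(\sigma)$ from an open set $\mathrm{Dom}(\sigma)\subseteq X$ onto an open set $\mathrm{Im}(\sigma)\subseteq X$; inductively $\mathrm{Dom}(\sigma^n)=\sigma^{-1}(\mathrm{Dom}(\sigma^{n-1}))$, with $\sigma^0=\mathrm{id}_X$. When $X$ is a metric space, its topology is the one induced by the metric $d$. A (finite) $\delta$-chain is an infinite sequence $(x_i)_{i=1}^\infty$ (respectively a finite sequence $(x_i)_{i=1}^k$) in $X$ such that $x_i\in\mathrm{Dom}(\sigma)$ and $d(\sigma(x_i),x_{i+1})<\delta$ for all $i$ (respectively for all $1\le i<k$; the last term need not be in $\mathrm{Dom}(\sigma)$). A point $x\in X$ $\varepsilon$-shadows a finite or infinite sequence $(y_i)_{i\ge1}$ if, for all indices $i$, $x\in\mathrm{Dom}(\sigma^{i-1})$ and $d(\sigma^{i-1}(x),y_i)<\varepsilon$. $(X,\sigma)$ has the (finite) shadowing property if for every $\varepsilon>0$ there is $\delta>0$ such that every infinite (respectively every finite) $\delta$-chain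 is $\varepsilon$-shadowed by some $x\in X$. For $D\subset X$, $(D,\sigma)$ has the (finite) shadowing property if for every $\varepsilon>0$ there is $\delta>0$ such that every infinite (respectively finite) $\delta$-chain formed by elements of $D$ is $\varepsilon$-shadowed by an element of $D$ (the set $D$ is not required to be $\sigma$-invariant). *)

theory Defs
  imports "HOL-Analysis.Analysis"
begin

definition local_homeomorphism_map ::
    "'a topology \<Rightarrow> 'b topology \<Rightarrow> ('a \<Rightarrow> 'b) \<Rightarrow> bool" where
  "local_homeomorphism_map X Y f \<longleftrightarrow>
     (\<forall>x\<in>topspace X. \<exists>W. openin X W \<and> x \<in> W \<and> openin Y (f ` W) \<and>
        homeomorphic_map (subtopology X W) (subtopology Y (f ` W)) f)"

text \<open>The partial map \<open>\<sigma>\<close> is represented by a total function together with its domain \<open>U\<close>;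
  the values of the function outside \<open>U\<close> are irrelevant, and the image of the partial map
  is \<open>\<sigma> ` U\<close>.\<close>

definition deaconu_renault :: "'a topology \<Rightarrow> 'a set \<Rightarrow> ('a \<Rightarrow> 'a) \<Rightarrow> bool" where
  "deaconu_renault X U \<sigma> \<longleftrightarrow>
     locally_compact_space X \<and> Hausdorff_space X \<and>
     openin X U \<and> openin X (\<sigma> ` U) \<and>
     local_homeomorphism_map (subtopology X U) (subtopology X (\<sigma> ` U)) \<sigma>"

text \<open>On \<open>iter_dom M U \<sigma> n\<close> the partial map \<open>\<sigma>\<^sup>n\<close> is given by \<open>\<sigma> ^^ n\<close>.\<close>

primrec iter_dom :: "'a set \<Rightarrow> 'a set \<Rightarrow> ('a \<Rightarrow> 'a) \<Rightarrow> nat \<Rightarrow> 'a set" where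
  "iter_dom M U \<sigma> 0 = M"
| "iter_dom M U \<sigma> (Suc n) = {x \<in> U. \<sigma> x \<in> iter_dom M U \<sigma> n}"

text \<open>All sequences are indexed from \<open>0\<close>; a finite sequence of length \<open>k\<close> is given by
  the values of a function on \<open>{..<k}\<close>. Finite chains have at least one term.\<close>

definition delta_chain ::
    "'a set \<Rightarrow> ('a \<Rightarrow> 'a \<Rightarrow> real) \<Rightarrow> 'a set \<Rightarrow> ('a \<Rightarrow> 'a) \<Rightarrow> real \<Rightarrow> (nat \<Rightarrow> 'a) \<Rightarrow> bool" where
  "delta_chain M d U \<sigma> \<delta> x \<longleftrightarrow>
     (\<forall>i. x i \<in> M) \<and> (\<forall>i. x i \<in> U \<and> d (\<sigma> (x i)) (x (Suc i)) < \<delta>)"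

definition finite_delta_chain ::
    "'a set \<Rightarrow> ('a \<Rightarrow> 'a \<Rightarrow> real) \<Rightarrow> 'a set \<Rightarrow> ('a \<Rightarrow> 'a) \<Rightarrow> real \<Rightarrow> nat \<Rightarrow> (nat \<Rightarrow> 'a) \<Rightarrow> bool" where
  "finite_delta_chain M d U \<sigma> \<delta> k x \<longleftrightarrow>
     1 \<le> k \<and> (\<forall>i<k. x i \<in> M) \<and>
     (\<forall>i. Suc i < k \<longrightarrow> x i \<in> U \<and> d (\<sigma> (x i)) (x (Suc i)) < \<delta>)"

text \<open>\<open>I\<close> is the index set of the sequence \<open>y\<close>: \<open>UNIV\<close> or \<open>{..<k}\<close>.\<close>

definition eps_shadows ::
    "'a set \<Rightarrow> ('a \<Rightarrow> 'a \<Rightarrow> real) \<Rightarrow> 'a set \<Rightarrow> ('a \<Rightarrow> 'a) \<Rightarrow> real \<Rightarrow> 'a \<Rightarrow> nat set \<Rightarrow> (nat \<Rightarrow> 'a) \<Rightarrow> bool" where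
  "eps_shadows M d U \<sigma> \<epsilon> z I y \<longleftrightarrow>
     (\<forall>i\<in>I. z \<in> iter_dom M U \<sigma> i \<and> d ((\<sigma> ^^ i) z) (y i) < \<epsilon>)"

text \<open>Shadowing for \<open>(D, \<sigma>)\<close> with \<open>D \<subseteq> M\<close>; the case of the whole system is \<open>D = M\<close>.\<close>

definition shadowing_property ::
    "'a set \<Rightarrow> ('a \<Rightarrow> 'a \<Rightarrow> real) \<Rightarrow> 'a set \<Rightarrow> ('a \<Rightarrow> 'a) \<Rightarrow> 'a set \<Rightarrow> bool" where
  "shadowing_property M d U \<sigma> D \<longleftrightarrow>
     (\<forall>\<epsilon>>0. \<exists>\<delta>>0. \<forall>x. delta_chain M d U \<sigma> \<delta> x \<and> (\<forall>i. x i \<in> D) \<longrightarrow>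
        (\<exists>z\<in>D. eps_shadows M d U \<sigma> \<epsilon> z UNIV x))"

definition finite_shadowing_property ::
    "'a set \<Rightarrow> ('a \<Rightarrow> 'a \<Rightarrow> real) \<Rightarrow> 'a set \<Rightarrow> ('a \<Rightarrow> 'a) \<Rightarrow> 'a set \<Rightarrow> bool" where
  "finite_shadowing_property M d U \<sigma> D \<longleftrightarrow>
     (\<forall>\<epsilon>>0. \<exists>\<delta>>0. \<forall>k x. finite_delta_chain M d U \<sigma> \<delta> k x \<and> (\<forall>i<k. x i \<in> D) \<longrightarrow>
        (\<exists>z\<in>D. eps_shadows M d U \<sigma> \<epsilon> z {..<k} x))"

end

(* A \<delta>/3-chain in X is perturbed termwise to a \<delta>-chain in D: near each term lying in Dom(\<sigma>),
   density and continuity of \<sigma> give a point of D that is close and has a close image.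
   For finite chains the last term may lie outside Dom(\<sigma>); there only closeness is needed,
   and density of Dom(\<sigma>) in X provides it. *)
theory Submission
  imports Defs
begin

text \<open>Continuity at a point only concerns a neighbourhood, and on the open set
  \<open>W\<close> the map is a homeomorphism onto its image. Sets open in the subspace
  \<open>W\<close> are open in \<open>X\<close> because \<open>W\<close> is, so preimages taken
  inside \<open>W\<close> serve as neighbourhoods in \<open>X\<close>.\<close>

lemma local_homeomorphism_map_imp_continuous_map:
  assumes "local_homeomorphism_map X Y f"
  shows "continuous_map X Y f"
  unfolding continuous_map_eq_topcontinuous_at
proof
  fix x assume x: "x \<in> topspace X"
  obtain W where W: "openin X W" "x \<in> W"
      and hom: "homeomorphic_map (subtopology X W) (subtopology Y (f ` W)) f"
    using assms x unfolding local_homeomorphism_map_def by blast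
  have into: "f \<in> topspace X \<rightarrow> topspace Y"
  proof
    fix y assume "y \<in> topspace X"
    then obtain V where "y \<in> V" "openin Y (f ` V)"
      using assms unfolding local_homeomorphism_map_def by blast
    then show "f y \<in> topspace Y"
      using openin_subset by blast
  qed
  have cont: "continuous_map (subtopology X W) Y f"
    using hom homeomorphic_imp_continuous_map continuous_map_into_fulltopology by blast
  have "\<exists>T. openin X T \<and> x \<in> T \<and> (\<forall>y\<in>T. f y \<in> V)" if V: "openin Y V" "f x \<in> V" for V
  proof -
    let ?T = "{y \<in> topspace (subtopology X W). f y \<in> V}"
    have "openin (subtopology X W) ?T"
      using cont V(1) by (rule openin_continuous_map_preimage)
    then have "openin X ?T"
      using W(1) by (simp add: openin_open_subtopology)
    then show ?thesis
      using x W(2) V(2) by (intro exI[of _ ?T]) auto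
  qed
  then show "topcontinuous_at X Y f x"
    using x into by (simp add: topcontinuous_at_def Pi_iff)
qed

context Metric_space
begin

text \<open>Every open neighbourhood of a point of the closure meets \<open>D\<close>. For
  \<open>x\<close> in \<open>U\<close> the neighbourhood is the \<open>\<eta>\<close>-ball cut down
  by a preimage of the ball around \<open>f x\<close>; otherwise the ball alone is used. The guarded
  form treats both kinds of chain terms at once.\<close>

lemma dense_approximation:
  assumes U: "openin mtopology U"
    and f: "continuous_map (subtopology mtopology U) mtopology f"
    and x: "x \<in> mtopology closure_of D"
    and "0 < \<eta>"
  shows "\<exists>y\<in>D. d x y < \<eta> \<and> (x \<in> U \<longrightarrow> d (f x) (f y) < \<eta>)"
proof -
  have xM: "x \<in> M"
    using x by (simp add: in_closure_of)
  have "\<exists>T. openin mtopology T \<and> x \<in> T \<and> T \<subseteq> mball x \<eta> \<and>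
          (x \<in> U \<longrightarrow> (\<forall>y\<in>T. f y \<in> mball (f x) \<eta>))"
  proof (cases "x \<in> U")
    case True
    let ?V = "{y \<in> topspace (subtopology mtopology U). f y \<in> mball (f x) \<eta>}"
    have xU: "x \<in> topspace (subtopology mtopology U)"
      using True xM by simp
    then have "f x \<in> M"
      using f unfolding continuous_map_def by (simp add: Pi_iff)
    then have "x \<in> ?V"
      using xU \<open>0 < \<eta>\<close> by simp
    moreover have "openin mtopology ?V"
      using openin_continuous_map_preimage[OF f openin_mball] U openin_open_subtopology by blast
    ultimately show ?thesis
      using xM \<open>0 < \<eta>\<close> by (intro exI[of _ "?V \<inter> mball x \<eta>"]) auto
  next
    case False
    then show ?thesis
      using xM \<open>0 < \<eta>\<close> by (intro exI[of _ "mball x \<eta>"]) auto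
  qed
  then obtain T where T: "openin mtopology T" "x \<in> T" "T \<subseteq> mball x \<eta>"
      "x \<in> U \<longrightarrow> (\<forall>y\<in>T. f y \<in> mball (f x) \<eta>)"
    by blast
  then obtain y where "y \<in> D" "y \<in> T"
    using x unfolding in_closure_of by blast
  with T show ?thesis
    by (intro bexI[of _ y]) auto
qed

text \<open>Go from \<open>a'\<close> to \<open>b'\<close> through \<open>a\<close> and
  \<open>b\<close>: three legs, each below \<open>\<delta> / 3\<close>. It is used with
  \<open>a\<close>, \<open>b\<close> the image of one chain term and the next term, and
  \<open>a'\<close>, \<open>b'\<close> their counterparts in the perturbed chain.\<close>

lemma chain_step_perturb:
  assumes "a \<in> M" "a' \<in> M" "b \<in> M" "b' \<in> M"
    and "d a a' < \<delta> / 3" "d a b < \<delta> / 3" "d b b' < \<delta> / 3"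
  shows "d a' b' < \<delta>"
  using assms triangle[of a' a b'] triangle[of a b b'] commute[of a' a] by linarith

text \<open>Triangle inequality through \<open>y i\<close>, each leg taking half of
  \<open>\<epsilon>\<close>.\<close>

lemma eps_shadows_perturb:
  assumes z: "eps_shadows M d U \<sigma> (\<epsilon> / 2) z I y"
    and near: "\<And>i. i \<in> I \<Longrightarrow> x i \<in> M \<and> y i \<in> M \<and> d (x i) (y i) < \<epsilon> / 2"
    and maps: "\<sigma> ` U \<subseteq> M"
  shows "eps_shadows M d U \<sigma> \<epsilon> z I x"
  unfolding eps_shadows_def
proof
  fix i assume i: "i \<in> I"
  \<comment> \<open>The recursion of \<open>iter_dom\<close> ends in \<open>M\<close>, so membership
    at level \<open>n\<close> already places the \<open>n\<close>-th iterate in \<open>M\<close>.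
    The recursion applies \<open>\<sigma>\<close> first, whence the generalization over
    \<open>w\<close> and the swap of the outer \<open>\<sigma>\<close> inwards.\<close>
  have iter: "(\<sigma> ^^ n) w \<in> M" if "w \<in> iter_dom M U \<sigma> n" for n w
    using that by (induction n arbitrary: w) (auto simp: funpow_swap1)
  have dom: "z \<in> iter_dom M U \<sigma> i" and "d ((\<sigma> ^^ i) z) (y i) < \<epsilon> / 2"
    using z i unfolding eps_shadows_def by auto
  then show "z \<in> iter_dom M U \<sigma> i \<and> d ((\<sigma> ^^ i) z) (x i) < \<epsilon>"
    using near[OF i] iter[OF dom] triangle[of "(\<sigma> ^^ i) z" "y i" "x i"]
      commute[of "x i" "y i"] by linarith
qed

context
  fixes U D :: "'a set" and \<sigma> :: "'a \<Rightarrow> 'a"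
  assumes U: "openin mtopology U"
    and cont: "continuous_map (subtopology mtopology U) mtopology \<sigma>"
    and DU: "D \<subseteq> U"
begin

private lemma UM: "U \<subseteq> M"
  using U openin_subset by fastforce

private lemma maps: "\<sigma> ` U \<subseteq> M"
  using cont UM unfolding continuous_map_def by auto

lemma shadowing_property_of_dense:
  assumes dense: "U \<subseteq> mtopology closure_of D"
    and sh: "shadowing_property M d U \<sigma> D"
  shows "shadowing_property M d U \<sigma> M"
  unfolding shadowing_property_def
proof (intro allI impI)
  fix \<epsilon> :: real assume "0 < \<epsilon>"
  then obtain \<delta> where "0 < \<delta>"
      and \<delta>: "\<And>x. delta_chain M d U \<sigma> \<delta> x \<and> (\<forall>i. x i \<in> D) \<Longrightarrow>
              \<exists>z\<in>D. eps_shadows M d U \<sigma> (\<epsilon> / 2) z UNIV x"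
    using sh half_gt_zero unfolding shadowing_property_def by metis
  \<comment> \<open>The bound \<open>\<epsilon> / 2\<close> pays for moving the shadowing from
    \<open>y\<close> back to \<open>x\<close>, the bound \<open>\<delta> / 3\<close> for turning the
    chain \<open>x\<close> into the chain \<open>y\<close>.\<close>
  define \<eta> where "\<eta> = min (\<epsilon> / 2) (\<delta> / 3)"
  have "0 < \<eta>"
    using \<open>0 < \<epsilon>\<close> \<open>0 < \<delta>\<close> by (simp add: \<eta>_def)
  have "\<exists>z\<in>M. eps_shadows M d U \<sigma> \<epsilon> z UNIV x" if ch: "delta_chain M d U \<sigma> (\<delta> / 3) x" for x
  proof -
    have xU: "x i \<in> U" and step: "d (\<sigma> (x i)) (x (Suc i)) < \<delta> / 3" for i
      using ch unfolding delta_chain_def by auto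
    have "\<exists>y\<in>D. d (x i) y < \<eta> \<and> (x i \<in> U \<longrightarrow> d (\<sigma> (x i)) (\<sigma> y) < \<eta>)" for i
      using dense xU by (intro dense_approximation U cont \<open>0 < \<eta>\<close>) auto
    \<comment> \<open>All terms of an infinite chain lie in \<open>U\<close>, so the guard on the
      image estimate disappears and density of \<open>D\<close> in \<open>U\<close> is
      enough.\<close>
    then obtain y where yD: "\<And>i. y i \<in> D" and near: "\<And>i. d (x i) (y i) < \<eta>"
        and near': "\<And>i. d (\<sigma> (x i)) (\<sigma> (y i)) < \<eta>"
      using xU by metis
    have in_M: "x i \<in> M" "y i \<in> M" "\<sigma> (x i) \<in> M" "\<sigma> (y i) \<in> M" for i
      using xU[of i] yD[of i] DU UM maps by auto
    have "d (\<sigma> (y i)) (y (Suc i)) < \<delta>" for i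
      by (rule chain_step_perturb[of "\<sigma> (x i)" _ "x (Suc i)"])
        (use near[of "Suc i"] near'[of i] step[of i] in_M in \<open>simp_all add: \<eta>_def\<close>)
    then have "delta_chain M d U \<sigma> \<delta> y"
      using yD DU in_M unfolding delta_chain_def by auto
    then obtain z where "z \<in> D" and z: "eps_shadows M d U \<sigma> (\<epsilon> / 2) z UNIV y"
      using \<delta> yD by blast
    have "eps_shadows M d U \<sigma> \<epsilon> z UNIV x"
      using near in_M by (intro eps_shadows_perturb[OF z _ maps]) (simp add: \<eta>_def)
    then show ?thesis
      using \<open>z \<in> D\<close> DU UM by blast
  qed
  then show "\<exists>\<delta>>0. \<forall>x. delta_chain M d U \<sigma> \<delta> x \<and> (\<forall>i. x i \<in> M) \<longrightarrow>
      (\<exists>z\<in>M. eps_shadows M d U \<sigma> \<epsilon> z UNIV x)"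
    using \<open>0 < \<delta>\<close> by (intro exI[of _ "\<delta> / 3"]) auto
qed

lemma finite_shadowing_property_of_dense:
  assumes dense: "M \<subseteq> mtopology closure_of D"
    and sh: "finite_shadowing_property M d U \<sigma> D"
  shows "finite_shadowing_property M d U \<sigma> M"
  unfolding finite_shadowing_property_def
proof (intro allI impI)
  fix \<epsilon> :: real assume "0 < \<epsilon>"
  then obtain \<delta> where "0 < \<delta>"
      and \<delta>: "\<And>k x. finite_delta_chain M d U \<sigma> \<delta> k x \<and> (\<forall>i<k. x i \<in> D) \<Longrightarrow>
              \<exists>z\<in>D. eps_shadows M d U \<sigma> (\<epsilon> / 2) z {..<k} x"
    using sh half_gt_zero unfolding finite_shadowing_property_def by metis
  define \<eta> where "\<eta> = min (\<epsilon> / 2) (\<delta> / 3)"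
  have "0 < \<eta>"
    using \<open>0 < \<epsilon>\<close> \<open>0 < \<delta>\<close> by (simp add: \<eta>_def)
  have "\<exists>z\<in>M. eps_shadows M d U \<sigma> \<epsilon> z {..<k} x"
    if ch: "finite_delta_chain M d U \<sigma> (\<delta> / 3) k x" for k x
  proof -
    have "1 \<le> k" and xM: "\<And>i. i < k \<Longrightarrow> x i \<in> M"
      and xU: "\<And>i. Suc i < k \<Longrightarrow> x i \<in> U"
      and step: "\<And>i. Suc i < k \<Longrightarrow> d (\<sigma> (x i)) (x (Suc i)) < \<delta> / 3"
      using ch unfolding finite_delta_chain_def by auto
    have "\<exists>y\<in>D. d (x i) y < \<eta> \<and> (x i \<in> U \<longrightarrow> d (\<sigma> (x i)) (\<sigma> y) < \<eta>)" if "i < k" for i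
      using dense xM[OF that] by (intro dense_approximation U cont \<open>0 < \<eta>\<close>) auto
    then obtain y where yD: "\<And>i. i < k \<Longrightarrow> y i \<in> D"
        and near: "\<And>i. i < k \<Longrightarrow> d (x i) (y i) < \<eta>"
        \<comment> \<open>The guard stays: the last term may lie outside \<open>U\<close>, where the
          values of \<open>\<sigma>\<close> carry no meaning.\<close>
        and near': "\<And>i. i < k \<Longrightarrow> x i \<in> U \<Longrightarrow> d (\<sigma> (x i)) (\<sigma> (y i)) < \<eta>"
      by metis
    have yM: "y i \<in> M" "\<sigma> (y i) \<in> M" if "i < k" for i
      using yD[OF that] DU UM maps by blast+
    \<comment> \<open>With \<open>Suc i < k\<close> the term \<open>x i\<close> is not the last one,
      hence lies in \<open>U\<close>, and the guarded estimate applies. The possibly exceptional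
      last term enters only as \<open>x (Suc i)\<close>, where closeness alone is needed.\<close>
    have "d (\<sigma> (y i)) (y (Suc i)) < \<delta>" if i: "Suc i < k" for i
    proof (rule chain_step_perturb)
      show "\<sigma> (x i) \<in> M"
        using xU[OF i] maps by blast
      show "d (\<sigma> (x i)) (\<sigma> (y i)) < \<delta> / 3" "d (x (Suc i)) (y (Suc i)) < \<delta> / 3"
        using near[OF i] near'[OF Suc_lessD[OF i] xU[OF i]] by (simp_all add: \<eta>_def)
    qed (use i xM yM step in auto)
    then have "finite_delta_chain M d U \<sigma> \<delta> k y"
      using \<open>1 \<le> k\<close> yD DU yM unfolding finite_delta_chain_def by auto
    then obtain z where "z \<in> D" and z: "eps_shadows M d U \<sigma> (\<epsilon> / 2) z {..<k} y"
      using \<delta> yD by blast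
    have "eps_shadows M d U \<sigma> \<epsilon> z {..<k} x"
      using near xM yM by (intro eps_shadows_perturb[OF z _ maps]) (simp add: \<eta>_def)
    then show ?thesis
      using \<open>z \<in> D\<close> DU UM by blast
  qed
  then show "\<exists>\<delta>>0. \<forall>k x. finite_delta_chain M d U \<sigma> \<delta> k x \<and> (\<forall>i<k. x i \<in> M) \<longrightarrow>
      (\<exists>z\<in>M. eps_shadows M d U \<sigma> \<epsilon> z {..<k} x)"
    using \<open>0 < \<delta>\<close> by (intro exI[of _ "\<delta> / 3"]) auto
qed

end

end

theorem proposition2p13:
  fixes M :: "'a set" and d :: "'a \<Rightarrow> 'a \<Rightarrow> real"
    and U D :: "'a set" and \<sigma> :: "'a \<Rightarrow> 'a"
  assumes "Metric_space M d"
    and "deaconu_renault (Metric_space.mtopology M d) U \<sigma>"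
    and "D \<subseteq> U"
    and "subtopology (Metric_space.mtopology M d) U closure_of D = U"
  shows "(shadowing_property M d U \<sigma> D \<longrightarrow> shadowing_property M d U \<sigma> M) \<and>
         (Metric_space.mtopology M d closure_of U = M \<and> finite_shadowing_property M d U \<sigma> D
            \<longrightarrow> finite_shadowing_property M d U \<sigma> M)"
proof -
  interpret Metric_space M d
    by (fact assms(1))
  have U: "openin mtopology U"
    using assms(2) by (simp add: deaconu_renault_def)
  have "continuous_map (subtopology mtopology U) (subtopology mtopology (\<sigma> ` U)) \<sigma>"
    using assms(2) local_homeomorphism_map_imp_continuous_map
    unfolding deaconu_renault_def by blast
  then have cont: "continuous_map (subtopology mtopology U) mtopology \<sigma>"
    by (rule continuous_map_into_fulltopology)
  \<comment> \<open>The closure relative to \<open>U\<close> is contained in the closure in the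
    whole space.\<close>
  have dense: "U \<subseteq> mtopology closure_of D"
    using assms(4) closure_of_subtopology_subset[of mtopology U D] by simp
  \<comment> \<open>Density is transitive: the closure of \<open>U\<close> lies in the closure of
    the closed set \<open>mtopology closure_of D\<close>, which is that set itself.\<close>
  have "M \<subseteq> mtopology closure_of D" if "mtopology closure_of U = M"
    using closure_of_mono[OF dense, of mtopology] that by simp
  then show ?thesis
    using shadowing_property_of_dense[OF U cont assms(3) dense]
      finite_shadowing_property_of_dense[OF U cont assms(3)] by blast
qed

end
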